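(* Let $q\in\mathbb{C}$ with $|q|>1$, let $n\ge 0$ be an integer and let $F=F(x,y_0,\ldots,y_n)$ be a polynomial in $n+2$ variables with complex coefficients. Suppose that the algebraic $q$-difference equation $$F(x,y,\sigma y,\ldots,\sigma^n y)=0$$ has a formal solution $y=\varphi$ in the form of a Dulac series $$\varphi=\sum_{k\ge 1}p_k(t)x^k,\qquad p_k\in\mathbb{C}[t],\quad t=\log_q x,$$ and suppose that there are an integer $m\ge 0$ (the same for all $j$), complex numbers $a_0,\ldots,a_n$ with $a_n\neq 0$, and polynomials $b_0,\dots,b_n\in\mathbb{C}[t]$ such that for every $j=0,1,\ldots,n$ $$\frac{\partial F}{\partial y_j}(x,\varphi,\sigma\varphi,\ldots,\sigma^n\varphi)=a_jx^m+b_j(t)x^{m+1}+\ldots$$ (where the dots denote terms with powers of $x$ higher than $m+1$ and coefficients in $\mathbb{C}[t]$). Then there exists $R>0$ such that for any sector $S=\{x:\ |x|<r,\ \arg x\in(\varphi_1,\varphi_2)\}$ with $r<R$ and $\varphi_2-\varphi_1<2\pi$, the series $\sum_{k\ge1}p_k(\log_q x)x^k$ converges uniformly on $S$.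
   Context: A Dulac series is a formal series $y=\sum_{k\ge1}p_k(t)x^k$ with $p_k\in\mathbb{C}[t]$, where $t=\log_q x=\frac{\ln x}{\ln q}$, with $\arg x\in(-\pi,\pi]$ and $\ln$ the fixed principal branch of the logarithm. In formal computations $t$ and $x$ are treated as independent, i.e. one works in $\mathbb{C}[t][[x]]$. The operator $\sigma$ corresponds to $(\sigma y)(x)=y(qx)$ and is defined on formal series by $$\sigma\Big(\sum_k p_k(t)x^k\Big)=\sum_k q^kp_k(t+1)x^k.$$ A Dulac series is a formal solution of $F(x,y,\sigma y,\ldots,\sigma^ny)=0$ if substituting it into the left-hand side gives the series in $\mathbb{C}[t][[x]]$ all of whose coefficients are zero. The sector $S$ does not contain $x=0$ (where $\arg x$ is undefined). *)

theory Defs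
  imports
    "HOL-Analysis.Analysis"
    "HOL-Library.Poly_Mapping"
    "HOL-Computational_Algebra.Polynomial"
    "HOL-Computational_Algebra.Formal_Power_Series"
begin

(* Multivariate polynomials over the complex numbers, encoded as finitely supported maps from
   monomials (finitely supported exponent vectors) to coefficients.  The ring structure is the
   convolution structure of Poly_Mapping. *)
type_synonym cpolynomial = "(nat \<Rightarrow>\<^sub>0 nat) \<Rightarrow>\<^sub>0 complex"

definition in_variables :: "nat set \<Rightarrow> cpolynomial \<Rightarrow> bool" where
  "in_variables V F \<longleftrightarrow> (\<forall>\<mu> \<in> Poly_Mapping.keys F. Poly_Mapping.keys \<mu> \<subseteq> V)"

(* Monomials free of variable i contribute with coefficient 0, so the truncated subtraction
   on exponents is harmless. *)
definition partial_deriv :: "nat \<Rightarrow> cpolynomial \<Rightarrow> cpolynomial" where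
  "partial_deriv i F =
     (\<Sum>\<mu> \<in> Poly_Mapping.keys F.
        Poly_Mapping.single (\<mu> - Poly_Mapping.single i 1)
          (of_nat (Poly_Mapping.lookup \<mu> i) * Poly_Mapping.lookup F \<mu>))"

(* C[t][[x]]: fps_X is x, and the k-th coefficient is a polynomial in the independent variable t. *)
type_synonym log_series = "complex poly fps"

definition substitute :: "cpolynomial \<Rightarrow> (nat \<Rightarrow> log_series) \<Rightarrow> log_series" where
  "substitute F f =
     (\<Sum>\<mu> \<in> Poly_Mapping.keys F.
        fps_const [:Poly_Mapping.lookup F \<mu>:] *
        (\<Prod>i \<in> Poly_Mapping.keys \<mu>. f i ^ Poly_Mapping.lookup \<mu> i))"

definition dulac_series :: "log_series \<Rightarrow> bool" where
  "dulac_series \<phi> \<longleftrightarrow> fps_nth \<phi> 0 = 0"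

(* p(t) x^k is sent to q^k p(t + 1) x^k *)
definition qshift :: "complex \<Rightarrow> log_series \<Rightarrow> log_series" where
  "qshift q \<phi> = Abs_fps (\<lambda>k. smult (q ^ k) (pcompose (fps_nth \<phi> k) [:1, 1:]))"

(* Variable 0 of the polynomial stands for x, variable j + 1 for y_j. *)
definition qdiff_args :: "complex \<Rightarrow> log_series \<Rightarrow> nat \<Rightarrow> log_series" where
  "qdiff_args q \<phi> i = (case i of 0 \<Rightarrow> fps_X | Suc j \<Rightarrow> (qshift q ^^ j) \<phi>)"

definition formal_solution :: "complex \<Rightarrow> cpolynomial \<Rightarrow> log_series \<Rightarrow> bool" where
  "formal_solution q F \<phi> \<longleftrightarrow> substitute F (qdiff_args q \<phi>) = 0"

(* Principal branches: Ln has imaginary part in (-pi, pi]. *)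
definition qlog :: "complex \<Rightarrow> complex \<Rightarrow> complex" where
  "qlog q x = Ln x / Ln q"

(* Arg is the principal argument, with values in (-pi, pi]; the apex 0 is not in the sector. *)
definition sector :: "real \<Rightarrow> real \<Rightarrow> real \<Rightarrow> complex set" where
  "sector r \<alpha> \<beta> = {x. x \<noteq> 0 \<and> norm x < r \<and> \<alpha> < Arg x \<and> Arg x < \<beta>}"

end

theory Submission
  imports Defs
begin

text \<open>
  Fix a large \<open>N > m\<close> and write \<open>\<phi> = \<phi>\<^sub>N + x\<^sup>N u\<close>, where \<open>\<phi>\<^sub>N\<close> is the part of \<open>\<phi>\<close>
  up to \<open>x\<^sup>N\<close> and \<open>u\<close> has no constant term. Expanding \<open>F\<close> at \<open>\<phi>\<^sub>N\<close>, the linear part is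
  governed by the derivatives \<open>a\<^sub>j x\<^sup>m + \<dots>\<close>, the quadratic part carries \<open>x\<^bsup>2N\<^esup>\<close>, and so after division
  by \<open>x\<^bsup>N+m\<^esup>\<close> the equation reads
  \<open>\<Sum>\<^sub>j a\<^sub>j u\<^sub>j = x H(u\<^sub>0, \<dots>, u\<^sub>n)\<close> (lemma \<open>reduced_equation\<close>). Here
  \<open>u\<^sub>j = x\<^bsup>-N\<^esup> \<sigma>\<^sup>j (x\<^sup>N u)\<close>, and \<open>H\<close> is a polynomial in the \<open>u\<^sub>j\<close> with coefficients in \<open>\<complex>[t][x]\<close>.
  The coefficients \<open>P\<^sub>k(t)\<close> of \<open>u\<close> are thus determined recursively:
  \<open>\<Sum>\<^sub>j a\<^sub>j q\<^bsup>j(N+k)\<^esup> P\<^sub>k(t + j)\<close> equals the coefficient of \<open>x\<^bsup>k-1\<^esup>\<close> in \<open>H(u\<^sub>0, \<dots>, u\<^sub>n)\<close>.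

  Since \<open>|q| > 1\<close> and \<open>a\<^sub>n \<noteq> 0\<close>, the term \<open>j = n\<close> dominates the sum on the left for large \<open>N\<close>.
  For the leading coefficients in \<open>t\<close> this means that no cancellation occurs, and it follows that
  \<open>degree P\<^sub>k \<le> C k\<close> for some \<open>C\<close>: the factor \<open>x\<close> in front of \<open>H\<close> pays for the bounded degrees in \<open>t\<close>
  that \<open>H\<close> contributes. For norms there is the obstacle that the shift \<open>t \<mapsto> t - 1\<close>, by which one
  passes from \<open>u\<^sub>j\<^sub>+\<^sub>1\<close> to \<open>u\<^sub>j\<close>, is not bounded uniformly in the degree. In the
  weighted norm \<open>\<Sum>\<^sub>i |c\<^sub>i| l\<^sup>i\<close>, however, its norm on polynomials of degree at most \<open>C k\<close> is at most
  \<open>(1 + 1/l)\<^bsup>C k\<^esup>\<close>, which for large \<open>l\<close> is absorbed by \<open>|q|\<^sup>k\<close>. So all \<open>u\<^sub>j\<close> are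
  controlled by \<open>u\<^sub>n\<close>, which in turn is controlled by \<open>x H(u)\<close>. With respect to a
  submultiplicative norm that gives \<open>x\<close> the small weight \<open>r\<close>, the unit ball
  is preserved, and induction on the order of truncation bounds \<open>u\<close>: the weighted norm of \<open>P\<^sub>k\<close> is
  at most \<open>1 / r\<^sup>k\<close> (lemma \<open>coefficient_growth\<close>).

  Finally \<open>t = log\<^sub>q x\<close> is unbounded near \<open>x = 0\<close>, but only logarithmically, so the degree
  bound gives \<open>|P\<^sub>k(t) x\<^sup>k| \<le> ((max 1 (|t|/l))\<^sup>C |x| / r)\<^sup>k\<close>, and the base is at most \<open>1/2\<close> for
  small \<open>x\<close> (lemma \<open>uniform_convergence_of_growth\<close>). The principal logarithm has bounded
  imaginary part, so the estimate is uniform on a whole punctured disc, which contains every small sector.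
\<close>

unbundle no vec_syntax
unbundle fps_syntax

section \<open>Series with finitely many nonzero coefficients\<close>

text \<open>
  The elements of \<open>\<complex>[t][x]\<close>, among all series in \<open>\<complex>[t][[x]]\<close>. For these the degree in \<open>t\<close>
  and the weighted norm, which bound the recursion for the coefficients, are automatically finite.
\<close>

definition finsupp :: "log_series \<Rightarrow> bool" where
  "finsupp c \<longleftrightarrow> (\<exists>K. \<forall>k>K. c $ k = 0)"

lemma finsupp_const: "finsupp (fps_const p)"
  by (auto simp: finsupp_def)

lemma finsupp_0 [simp]: "finsupp 0" and finsupp_1 [simp]: "finsupp 1"
  by (auto simp: finsupp_def)

lemma finsupp_X [simp]: "finsupp fps_X"
  unfolding finsupp_def by (rule exI[of _ 1]) (auto simp: fps_X_def)

lemma finsupp_add: "finsupp c \<Longrightarrow> finsupp d \<Longrightarrow> finsupp (c + d)"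
  unfolding finsupp_def
proof (elim exE)
  fix K L assume "\<forall>k>K. c $ k = 0" "\<forall>k>L. d $ k = 0"
  then have "\<forall>k>max K L. (c + d) $ k = 0" by simp
  then show "\<exists>K. \<forall>k>K. (c + d) $ k = 0" by blast
qed

lemma finsupp_mult: "finsupp c \<Longrightarrow> finsupp d \<Longrightarrow> finsupp (c * d)"
  unfolding finsupp_def
proof (elim exE)
  fix K L assume *: "\<forall>k>K. c $ k = 0" "\<forall>k>L. d $ k = 0"
  have "(c * d) $ k = 0" if "k > K + L" for k
    unfolding fps_mult_nth
  proof (rule sum.neutral, rule ballI)
    fix i
    have "i > K \<or> k - i > L" using that by linarith
    then show "c $ i * d $ (k - i) = 0" using * by auto
  qed
  then show "\<exists>K. \<forall>k>K. (c * d) $ k = 0" by blast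
qed

lemma finsupp_power: "finsupp c \<Longrightarrow> finsupp (c ^ e)"
  by (induction e) (auto intro: finsupp_mult)

lemma finsupp_sum: "(\<And>i. i \<in> S \<Longrightarrow> finsupp (c i)) \<Longrightarrow> finsupp (\<Sum>i\<in>S. c i)"
  by (induction S rule: infinite_finite_induct) (auto intro: finsupp_add)

lemma finsupp_prod: "(\<And>i. i \<in> S \<Longrightarrow> finsupp (c i)) \<Longrightarrow> finsupp (\<Prod>i\<in>S. c i)"
  by (induction S rule: infinite_finite_induct) (auto intro: finsupp_mult)

lemma finsupp_shift: "finsupp c \<Longrightarrow> finsupp (fps_shift s c)"
  unfolding finsupp_def fps_shift_nth by (metis trans_less_add1)

section \<open>Graded polynomial operators\<close>

text \<open>
  Polynomials in the unknown series \<open>w i\<close>, \<open>i \<in> V\<close>, over \<open>\<complex>[t][x]\<close>, seen as functions of \<open>w\<close>, in which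
  every monomial has degree at least \<open>d\<close>. Estimates need only the closure
  properties, by rule induction, so no normal form is ever written down. The grading \<open>d\<close> records how
  many powers of \<open>x\<close> come out when \<open>w\<close> is a multiple of a power of \<open>x\<close>.
\<close>

inductive polyop :: "nat set \<Rightarrow> nat \<Rightarrow> ((nat \<Rightarrow> log_series) \<Rightarrow> log_series) \<Rightarrow> bool"
  for V where
  zero: "polyop V d (\<lambda>w. 0)"
| const: "finsupp c \<Longrightarrow> polyop V 0 (\<lambda>w. c)"
| var: "i \<in> V \<Longrightarrow> polyop V 1 (\<lambda>w. w i)"
| add: "polyop V d g \<Longrightarrow> polyop V d h \<Longrightarrow> polyop V d (\<lambda>w. g w + h w)"
| mult: "polyop V d g \<Longrightarrow> polyop V e h \<Longrightarrow> polyop V (d + e) (\<lambda>w. g w * h w)"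
| lower: "polyop V (Suc d) g \<Longrightarrow> polyop V d g"

lemma polyop_mult0: "finsupp c \<Longrightarrow> polyop V d g \<Longrightarrow> polyop V d (\<lambda>w. c * g w)"
  using polyop.mult[OF polyop.const, of c V d g] by simp

lemma polyop_sum:
  "(\<And>i. i \<in> S \<Longrightarrow> polyop V d (g i)) \<Longrightarrow> polyop V d (\<lambda>w. \<Sum>i\<in>S. g i w)"
  by (induction S rule: infinite_finite_induct) (auto intro: polyop.intros)

lemma polyop_to_zero: "polyop V d g \<Longrightarrow> polyop V 0 g"
  by (induction d) (auto intro: polyop.intros)

lemma polyop_scale:
  assumes "polyop V d g"
  shows "\<exists>h. polyop V 0 h \<and> (\<forall>u. g (\<lambda>i. fps_X ^ N * u i) = fps_X ^ (d * N) * h u)"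
  using assms
proof induction
  case (zero d)
  show ?case by (rule exI[of _ "\<lambda>_. 0"]) (auto intro: polyop.zero)
next
  case (const c)
  then show ?case by (intro exI[of _ "\<lambda>_. c"]) (auto intro: polyop.const)
next
  case (var i)
  then show ?case by (intro exI[of _ "\<lambda>u. u i"]) (auto intro: polyop_to_zero polyop.var)
next
  case (add d g h)
  then obtain g' h' where
    "polyop V 0 g'" "\<forall>u. g (\<lambda>i. fps_X ^ N * u i) = fps_X ^ (d * N) * g' u"
    "polyop V 0 h'" "\<forall>u. h (\<lambda>i. fps_X ^ N * u i) = fps_X ^ (d * N) * h' u" by blast
  then show ?case
    by (intro exI[of _ "\<lambda>u. g' u + h' u"]) (auto intro: polyop.add simp: distrib_left)
next
  case (mult d g e h)
  then obtain g' h' where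
    *: "polyop V 0 g'" "\<forall>u. g (\<lambda>i. fps_X ^ N * u i) = fps_X ^ (d * N) * g' u"
    "polyop V 0 h'" "\<forall>u. h (\<lambda>i. fps_X ^ N * u i) = fps_X ^ (e * N) * h' u" by blast
  have "fps_X ^ (d * N) * a * (fps_X ^ (e * N) * b) = fps_X ^ ((d + e) * N) * (a * b)"
    for a b :: log_series
    unfolding distrib_right power_add by (simp only: mult_ac)
  then show ?case using polyop.mult[OF *(1) *(3)] *(2,4)
    by (intro exI[of _ "\<lambda>u. g' u * h' u"]) simp
next
  case (lower d g)
  then obtain g' where
    *: "polyop V 0 g'" "\<forall>u. g (\<lambda>i. fps_X ^ N * u i) = fps_X ^ (Suc d * N) * g' u" by blast
  have "polyop V 0 (\<lambda>u. fps_X ^ N * g' u)"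
    by (intro polyop_mult0 * finsupp_power finsupp_X)
  then show ?case using *
    by (intro exI[of _ "\<lambda>u. fps_X ^ N * g' u"]) (auto simp: power_add mult_ac)
qed

text \<open>
  A monomial of weight \<open>k\<close> in \<open>x\<close> inherits the slope \<open>C\<close> from the unknowns; the coefficients of \<open>g\<close>
  contribute a constant \<open>D\<close> that depends neither on \<open>C\<close> nor on the unknowns. This independence allows
  choosing \<open>C = D\<close> later. The truncation order \<open>K\<close> makes the statement usable in an induction on \<open>k\<close>.
\<close>

lemma polyop_degree:
  assumes "polyop V d g"
  shows "\<exists>D. \<forall>C K u. (\<forall>i\<in>V. \<forall>k\<le>K. degree (u i $ k) \<le> C * k) \<longrightarrow>
           (\<forall>k\<le>K. degree (g u $ k) \<le> D + C * k)"
  using assms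
proof induction
  case (const c)
  then obtain K0 where K0: "\<forall>k>K0. c $ k = 0" by (auto simp: finsupp_def)
  have "degree (c $ k) \<le> (\<Sum>k\<le>K0. degree (c $ k))" for k
    using K0 by (cases "k \<le> K0") (auto intro: member_le_sum)
  then show ?case by (meson le_add1 order_trans)
next
  case (add d g h)
  then obtain D1 D2 where
    "\<forall>C K u. (\<forall>i\<in>V. \<forall>k\<le>K. degree (u i $ k) \<le> C * k) \<longrightarrow> (\<forall>k\<le>K. degree (g u $ k) \<le> D1 + C * k)"
    "\<forall>C K u. (\<forall>i\<in>V. \<forall>k\<le>K. degree (u i $ k) \<le> C * k) \<longrightarrow> (\<forall>k\<le>K. degree (h u $ k) \<le> D2 + C * k)"
    by blast
  then have "\<forall>C K u. (\<forall>i\<in>V. \<forall>k\<le>K. degree (u i $ k) \<le> C * k) \<longrightarrow>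
      (\<forall>k\<le>K. degree ((g u + h u) $ k) \<le> (D1 + D2) + C * k)"
    unfolding fps_add_nth
    by (intro allI impI degree_add_le) (meson add_le_mono1 le_add1 le_add2 order_trans)+
  then show ?case by blast
next
  case (mult d g e h)
  then obtain D1 D2 where D:
    "\<And>C K u. (\<forall>i\<in>V. \<forall>k\<le>K. degree (u i $ k) \<le> C * k) \<longrightarrow> (\<forall>k\<le>K. degree (g u $ k) \<le> D1 + C * k)"
    "\<And>C K u. (\<forall>i\<in>V. \<forall>k\<le>K. degree (u i $ k) \<le> C * k) \<longrightarrow> (\<forall>k\<le>K. degree (h u $ k) \<le> D2 + C * k)"
    by blast
  have "degree ((g u * h u) $ k) \<le> (D1 + D2) + C * k"
    if "\<forall>i\<in>V. \<forall>k\<le>K. degree (u i $ k) \<le> C * k" "k \<le> K" for C K u k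
    unfolding fps_mult_nth
  proof (rule degree_sum_le)
    fix i assume i: "i \<in> {0..k}"
    have "degree (g u $ i * h u $ (k - i)) \<le> degree (g u $ i) + degree (h u $ (k - i))"
      by (rule degree_mult_le)
    also have "\<dots> \<le> (D1 + C * i) + (D2 + C * (k - i))"
      using i that D[of K u C] by (intro add_mono) auto
    also have "\<dots> = (D1 + D2) + C * k"
      using i by (simp flip: distrib_left)
    finally show "degree (g u $ i * h u $ (k - i)) \<le> (D1 + D2) + C * k" .
  qed auto
  then show ?case by blast
next
  case (zero d)
  show ?case by (rule exI[of _ 0]) simp
next
  case (var i)
  then show ?case by (intro exI[of _ 0]) simp
qed

section \<open>Weighted norms on polynomials and series\<close>

definition wnorm :: "real \<Rightarrow> complex poly \<Rightarrow> real" where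
  "wnorm l p = poly (map_poly norm p) l"

lemma wnorm_0 [simp]: "wnorm l 0 = 0"
  by (simp add: wnorm_def)

lemma wnorm_pCons [simp]: "wnorm l (pCons c p) = norm c + l * wnorm l p"
  by (simp add: wnorm_def map_poly_pCons)

lemma wnorm_altdef: "wnorm l p = (\<Sum>i\<le>degree p. norm (coeff p i) * l ^ i)"
  by (simp add: wnorm_def poly_altdef coeff_map_poly degree_map_poly)

lemma wnorm_nonneg: "l \<ge> 0 \<Longrightarrow> wnorm l p \<ge> 0"
  by (induction p) auto

lemma wnorm_add: "l \<ge> 0 \<Longrightarrow> wnorm l (p + q) \<le> wnorm l p + wnorm l q"
proof (induction p q rule: poly_induct2)
  case (pCons a p b q)
  have "norm (a + b) + l * wnorm l (p + q) \<le> (norm a + norm b) + l * (wnorm l p + wnorm l q)"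
    using pCons by (intro add_mono mult_left_mono norm_triangle_ineq) auto
  then show ?case by (simp add: algebra_simps)
qed auto

lemma wnorm_sum: "l \<ge> 0 \<Longrightarrow> wnorm l (\<Sum>i\<in>S. p i) \<le> (\<Sum>i\<in>S. wnorm l (p i))"
proof (induction S rule: infinite_finite_induct)
  case (insert x S)
  then show ?case using wnorm_add[of l "p x" "\<Sum>i\<in>S. p i"] by simp
qed auto

lemma wnorm_smult: "wnorm l (smult c p) = norm c * wnorm l p"
  by (induction p) (auto simp: norm_mult algebra_simps)

lemma wnorm_minus: "wnorm l (- p) = wnorm l p"
  using wnorm_smult[of l "-1" p] by simp

lemma wnorm_mult: "l \<ge> 0 \<Longrightarrow> wnorm l (p * q) \<le> wnorm l p * wnorm l q"
proof (induction p)
  case (pCons a p)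
  have "wnorm l (pCons a p * q) \<le> wnorm l (smult a q) + wnorm l (pCons 0 (p * q))"
    unfolding mult_pCons_left by (rule wnorm_add[OF pCons.prems])
  also have "\<dots> \<le> norm a * wnorm l q + l * (wnorm l p * wnorm l q)"
    using pCons by (auto simp: wnorm_smult intro: mult_left_mono)
  finally show ?case by (simp add: algebra_simps)
qed auto

text \<open>
  Substituting \<open>t + b\<close> for \<open>t\<close> is Horner's scheme with \<open>t + b\<close>, a polynomial of norm \<open>l + |b|\<close>.
\<close>

lemma wnorm_translate:
  assumes "l \<ge> 0" shows "wnorm l (pcompose p [:b, 1:]) \<le> wnorm (l + norm b) p"
proof (induction p)
  case (pCons a p)
  have "wnorm l (pcompose (pCons a p) [:b, 1:]) \<le> wnorm l [:a:] + wnorm l ([:b, 1:] * pcompose p [:b, 1:])"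
    unfolding pcompose_pCons by (rule wnorm_add[OF assms])
  also have "\<dots> \<le> norm a + wnorm l [:b, 1:] * wnorm l (pcompose p [:b, 1:])"
    using wnorm_mult[OF assms, of "[:b, 1:]"] by simp
  also have "\<dots> \<le> norm a + (l + norm b) * wnorm (l + norm b) p"
    using pCons.IH assms by (intro add_mono mult_mono wnorm_nonneg) auto
  finally show ?case by simp
qed auto

lemma wnorm_enlarge:
  assumes "0 < l" "l \<le> l'" "degree p \<le> d"
  shows "wnorm l' p \<le> (l' / l) ^ d * wnorm l p"
proof -
  have "norm (coeff p i) * l' ^ i \<le> (l' / l) ^ d * (norm (coeff p i) * l ^ i)" if "i \<le> degree p" for i
  proof -
    have "l' ^ i = (l' / l) ^ i * l ^ i" using assms by (simp add: power_divide)
    also have "\<dots> \<le> (l' / l) ^ d * l ^ i"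
      using assms that by (intro mult_right_mono power_increasing) auto
    finally show ?thesis by (simp add: mult.left_commute mult_left_mono)
  qed
  then show ?thesis unfolding wnorm_altdef sum_distrib_left by (auto intro: sum_mono)
qed

lemma norm_poly_le_wnorm: "norm (poly p z) \<le> wnorm (norm z) p"
proof (induction p)
  case (pCons a p)
  have "norm (poly (pCons a p) z) \<le> norm a + norm z * norm (poly p z)"
    by (simp add: norm_triangle_le norm_mult)
  also have "\<dots> \<le> norm a + norm z * wnorm (norm z) p"
    using pCons by (intro add_mono mult_left_mono) auto
  finally show ?case by simp
qed auto

text \<open>
  Partial sums of the norm \<open>\<Sum>\<^sub>k \<parallel>f\<^sub>k\<parallel> r\<^sup>k\<close>, whose finiteness is what has to be proved.
  The coefficients up to \<open>K\<close> of a product depend only on those of the factors, so the truncated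
  norms are submultiplicative as well.
\<close>

definition trunc_norm :: "real \<Rightarrow> real \<Rightarrow> nat \<Rightarrow> log_series \<Rightarrow> real" where
  "trunc_norm l r K f = (\<Sum>k\<le>K. wnorm l (f $ k) * r ^ k)"

lemma trunc_norm_nonneg: "l \<ge> 0 \<Longrightarrow> r \<ge> 0 \<Longrightarrow> trunc_norm l r K f \<ge> 0"
  unfolding trunc_norm_def by (intro sum_nonneg mult_nonneg_nonneg wnorm_nonneg) auto

lemma trunc_norm_add:
  assumes "l \<ge> 0" "r \<ge> 0"
  shows "trunc_norm l r K (f + g) \<le> trunc_norm l r K f + trunc_norm l r K g"
  unfolding trunc_norm_def fps_add_nth sum.distrib[symmetric] distrib_right[symmetric]
  using assms by (intro sum_mono mult_right_mono wnorm_add) auto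

lemma trunc_norm_mult:
  assumes l: "l \<ge> 0" and r: "r \<ge> 0"
  shows "trunc_norm l r K (f * g) \<le> trunc_norm l r K f * trunc_norm l r K g"
proof -
  let ?F = "\<lambda>i j. (wnorm l (f $ i) * r ^ i) * (wnorm l (g $ j) * r ^ j)"
  have "wnorm l ((f * g) $ k) * r ^ k \<le> (\<Sum>i\<le>k. ?F i (k - i))" for k
  proof -
    have "wnorm l ((f * g) $ k) \<le> (\<Sum>i\<le>k. wnorm l (f $ i * g $ (k - i)))"
      unfolding fps_mult_nth atLeast0AtMost by (rule wnorm_sum[OF l])
    also have "\<dots> \<le> (\<Sum>i\<le>k. wnorm l (f $ i) * wnorm l (g $ (k - i)))"
      by (intro sum_mono wnorm_mult l)
    finally have "wnorm l ((f * g) $ k) * r ^ k \<le> (\<Sum>i\<le>k. wnorm l (f $ i) * wnorm l (g $ (k - i))) * r ^ k"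
      using r by (intro mult_right_mono) auto
    also have "\<dots> = (\<Sum>i\<le>k. ?F i (k - i))"
      unfolding sum_distrib_right
    proof (rule sum.cong[OF refl])
      fix i assume "i \<in> {..k}"
      then have "r ^ k = r ^ i * r ^ (k - i)" by (simp flip: power_add)
      then show "wnorm l (f $ i) * wnorm l (g $ (k - i)) * r ^ k = ?F i (k - i)" by simp
    qed
    finally show ?thesis .
  qed
  then have "trunc_norm l r K (f * g) \<le> (\<Sum>k\<le>K. \<Sum>i\<le>k. ?F i (k - i))"
    unfolding trunc_norm_def by (rule sum_mono)
  also have "\<dots> = (\<Sum>(i, j)\<in>{(i, j). i + j \<le> K}. ?F i j)"
    by (rule sum.triangle_reindex_eq[symmetric])
  also have "\<dots> \<le> (\<Sum>(i, j)\<in>{..K} \<times> {..K}. ?F i j)"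
    using l r by (intro sum_mono2) (auto intro!: mult_nonneg_nonneg wnorm_nonneg)
  also have "\<dots> = trunc_norm l r K f * trunc_norm l r K g"
    unfolding trunc_norm_def sum_product sum.cartesian_product ..
  finally show ?thesis .
qed

text \<open>
  The bound is uniform in \<open>r \<le> 1\<close>, so that \<open>r\<close> can be chosen after \<open>M\<close>.
\<close>

lemma polyop_trunc_norm:
  assumes "polyop V d g" and l: "l \<ge> 0"
  shows "\<exists>M. \<forall>r K u. 0 \<le> r \<and> r \<le> 1 \<and> (\<forall>i\<in>V. trunc_norm l r K (u i) \<le> 1) \<longrightarrow>
           trunc_norm l r K (g u) \<le> M"
  using assms(1)
proof induction
  case (const c)
  then obtain K0 where K0: "\<forall>k>K0. c $ k = 0" by (auto simp: finsupp_def)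
  have "trunc_norm l r K c \<le> (\<Sum>k\<le>K0. wnorm l (c $ k))" if r: "0 \<le> r" "r \<le> 1" for r K
  proof -
    have "trunc_norm l r K c \<le> (\<Sum>k\<le>K. wnorm l (c $ k))"
      unfolding trunc_norm_def using r l
      by (intro sum_mono mult_right_le_one_le wnorm_nonneg) (auto simp: power_le_one)
    also have "\<dots> \<le> (\<Sum>k\<le>max K K0. wnorm l (c $ k))"
      using l by (intro sum_mono2) (auto intro: wnorm_nonneg)
    also have "\<dots> = (\<Sum>k\<le>K0. wnorm l (c $ k))"
      using K0 by (intro sum.mono_neutral_right) auto
    finally show ?thesis .
  qed
  then show ?case by blast
next
  case (add d g h)
  then obtain M1 M2 where M:
    "\<forall>r K u. 0 \<le> r \<and> r \<le> 1 \<and> (\<forall>i\<in>V. trunc_norm l r K (u i) \<le> 1) \<longrightarrow> trunc_norm l r K (g u) \<le> M1"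
    "\<forall>r K u. 0 \<le> r \<and> r \<le> 1 \<and> (\<forall>i\<in>V. trunc_norm l r K (u i) \<le> 1) \<longrightarrow> trunc_norm l r K (h u) \<le> M2"
    by blast
  have "trunc_norm l r K (g u + h u) \<le> M1 + M2"
    if "0 \<le> r" "r \<le> 1" "\<forall>i\<in>V. trunc_norm l r K (u i) \<le> 1" for r K u
    using trunc_norm_add[OF l \<open>0 \<le> r\<close>, of K "g u" "h u"] M that
    by (meson add_mono order_trans)
  then show ?case by blast
next
  case (mult d g e h)
  then obtain M1 M2 where M:
    "\<forall>r K u. 0 \<le> r \<and> r \<le> 1 \<and> (\<forall>i\<in>V. trunc_norm l r K (u i) \<le> 1) \<longrightarrow> trunc_norm l r K (g u) \<le> M1"
    "\<forall>r K u. 0 \<le> r \<and> r \<le> 1 \<and> (\<forall>i\<in>V. trunc_norm l r K (u i) \<le> 1) \<longrightarrow> trunc_norm l r K (h u) \<le> M2"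
    by blast
  have "trunc_norm l r K (g u * h u) \<le> M1 * M2"
    if r: "0 \<le> r" "r \<le> 1" and u: "\<forall>i\<in>V. trunc_norm l r K (u i) \<le> 1" for r K u
  proof -
    have "trunc_norm l r K (g u) \<le> M1" "trunc_norm l r K (h u) \<le> M2"
      using M r u by blast+
    moreover have "0 \<le> trunc_norm l r K (g u)" "0 \<le> trunc_norm l r K (h u)"
      using l r by (auto intro: trunc_norm_nonneg)
    ultimately have "trunc_norm l r K (g u) * trunc_norm l r K (h u) \<le> M1 * M2"
      by (intro mult_mono) auto
    then show ?thesis using trunc_norm_mult[OF l r(1), of K "g u" "h u"] by linarith
  qed
  then show ?case by blast
next
  case (zero d)
  show ?case by (rule exI[of _ 0]) (simp add: trunc_norm_def)
next
  case (var i)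
  then show ?case by (intro exI[of _ 1]) simp
qed

section \<open>Taylor expansion of a polynomial at a tuple of series\<close>

text \<open>
  With the product taken over the fixed set \<open>V\<close> instead of the support of \<open>\<mu>\<close>, monomials
  and their derivatives are products over the same index set.
\<close>

definition monomial_value :: "nat set \<Rightarrow> (nat \<Rightarrow> log_series) \<Rightarrow> (nat \<Rightarrow>\<^sub>0 nat) \<Rightarrow> log_series" where
  "monomial_value V f \<mu> = (\<Prod>i\<in>V. f i ^ Poly_Mapping.lookup \<mu> i)"

lemma substitute_superset:
  assumes "finite S" "Poly_Mapping.keys F \<subseteq> S"
  shows "substitute F f = (\<Sum>\<mu>\<in>S. fps_const [:Poly_Mapping.lookup F \<mu>:] *
           (\<Prod>i\<in>Poly_Mapping.keys \<mu>. f i ^ Poly_Mapping.lookup \<mu> i))"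
  unfolding substitute_def using assms
  by (intro sum.mono_neutral_left) (auto simp: in_keys_iff)

lemma substitute_add: "substitute (F + G) f = substitute F f + substitute G f"
proof -
  let ?S = "Poly_Mapping.keys F \<union> Poly_Mapping.keys G"
  have S: "finite ?S" "Poly_Mapping.keys (F + G) \<subseteq> ?S"
    by (simp_all add: Poly_Mapping.keys_add)
  have "fps_const [:a + b:] = (fps_const [:a:] + fps_const [:b:] :: log_series)" for a b
    by simp
  then show ?thesis
    unfolding substitute_superset[OF S] substitute_superset[OF S(1) Un_upper1]
      substitute_superset[OF S(1) Un_upper2] lookup_add
    by (simp only: distrib_right sum.distrib)
qed

lemma substitute_zero: "substitute 0 f = 0"
  by (simp add: substitute_def)

lemma substitute_sum: "substitute (\<Sum>i\<in>S. F i) f = (\<Sum>i\<in>S. substitute (F i) f)"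
  by (induction S rule: infinite_finite_induct) (auto simp: substitute_add substitute_zero)

lemma substitute_single:
  "substitute (Poly_Mapping.single \<mu> c) f =
     fps_const [:c:] * (\<Prod>i\<in>Poly_Mapping.keys \<mu>. f i ^ Poly_Mapping.lookup \<mu> i)"
  by (simp add: substitute_def)

lemma prod_keys_eq_monomial_value:
  assumes "finite V" "Poly_Mapping.keys \<mu> \<subseteq> V"
  shows "(\<Prod>i\<in>Poly_Mapping.keys \<mu>. f i ^ Poly_Mapping.lookup \<mu> i) = monomial_value V f \<mu>"
  unfolding monomial_value_def using assms
  by (intro prod.mono_neutral_left) (auto simp: in_keys_iff)

lemma substitute_eq_monomial_values:
  assumes "finite V" "in_variables V F"
  shows "substitute F f =
    (\<Sum>\<mu>\<in>Poly_Mapping.keys F. fps_const [:Poly_Mapping.lookup F \<mu>:] * monomial_value V f \<mu>)"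
  unfolding substitute_def using assms
  by (intro sum.cong refl) (simp add: prod_keys_eq_monomial_value in_variables_def)

lemma substitute_partial_deriv:
  assumes "finite V" "in_variables V F"
  shows "substitute (partial_deriv i F) f =
    (\<Sum>\<mu>\<in>Poly_Mapping.keys F. fps_const [:Poly_Mapping.lookup F \<mu>:] *
       (of_nat (Poly_Mapping.lookup \<mu> i) * monomial_value V f (\<mu> - Poly_Mapping.single i 1)))"
  unfolding partial_deriv_def substitute_sum
proof (rule sum.cong[OF refl])
  fix \<mu> assume \<mu>: "\<mu> \<in> Poly_Mapping.keys F"
  have "Poly_Mapping.keys (\<mu> - Poly_Mapping.single i 1) \<subseteq> Poly_Mapping.keys \<mu>"
    by (auto simp: in_keys_iff lookup_minus)
  then have "Poly_Mapping.keys (\<mu> - Poly_Mapping.single i 1) \<subseteq> V"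
    using \<mu> assms by (auto simp: in_variables_def)
  moreover have "fps_const [:of_nat k * c:] = fps_const [:c:] * (of_nat k :: log_series)"
    for k and c :: complex
    by (simp add: fps_of_nat[symmetric] of_nat_poly mult.commute)
  ultimately show "substitute (Poly_Mapping.single (\<mu> - Poly_Mapping.single i 1)
      (of_nat (Poly_Mapping.lookup \<mu> i) * Poly_Mapping.lookup F \<mu>)) f =
    fps_const [:Poly_Mapping.lookup F \<mu>:] *
       (of_nat (Poly_Mapping.lookup \<mu> i) * monomial_value V f (\<mu> - Poly_Mapping.single i 1))"
    by (simp add: substitute_single prod_keys_eq_monomial_value[OF assms(1)] mult.assoc)
qed

text \<open>
  The first-order expansion of \<open>g\<close> at \<open>w = 0\<close>, with value \<open>g0\<close>, partial derivatives \<open>c i\<close> and a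
  remainder of second order. The product rule turns this into a calculus, which avoids an explicit Taylor formula
  in several variables.
\<close>

definition has_linearization ::
  "nat set \<Rightarrow> ((nat \<Rightarrow> log_series) \<Rightarrow> log_series) \<Rightarrow> log_series \<Rightarrow> (nat \<Rightarrow> log_series) \<Rightarrow> bool" where
  "has_linearization V g g0 c \<longleftrightarrow> finsupp g0 \<and> (\<forall>i\<in>V. finsupp (c i)) \<and>
     (\<exists>R. polyop V 2 R \<and> (\<forall>w. g w = g0 + (\<Sum>i\<in>V. c i * w i) + R w))"

lemma has_linearization_const:
  "finsupp g0 \<Longrightarrow> has_linearization V (\<lambda>w. g0) g0 (\<lambda>i. 0)"
  unfolding has_linearization_def by (auto intro!: exI[of _ "\<lambda>w. 0"] polyop.zero)

lemma has_linearization_var: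
  "finite V \<Longrightarrow> i \<in> V \<Longrightarrow> finsupp (f i) \<Longrightarrow>
   has_linearization V (\<lambda>w. f i + w i) (f i) (\<lambda>j. if j = i then 1 else 0)"
  unfolding has_linearization_def
  by (auto intro!: exI[of _ "\<lambda>w. 0"] polyop.zero simp: if_distrib[of "\<lambda>x. x * _"] cong: if_cong)

lemma has_linearization_add:
  assumes "has_linearization V g g0 c" "has_linearization V h h0 d"
  shows "has_linearization V (\<lambda>w. g w + h w) (g0 + h0) (\<lambda>i. c i + d i)"
proof -
  obtain R S where
    "polyop V 2 R" "\<forall>w. g w = g0 + (\<Sum>i\<in>V. c i * w i) + R w"
    "polyop V 2 S" "\<forall>w. h w = h0 + (\<Sum>i\<in>V. d i * w i) + S w"
    using assms unfolding has_linearization_def by blast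
  then have "polyop V 2 (\<lambda>w. R w + S w) \<and> (\<forall>w. g w + h w = (g0 + h0) + (\<Sum>i\<in>V. (c i + d i) * w i) + (R w + S w))"
    by (auto intro: polyop.add simp: distrib_right sum.distrib algebra_simps)
  then show ?thesis
    using assms unfolding has_linearization_def by (blast intro: finsupp_add)
qed

lemma has_linearization_mult:
  assumes "has_linearization V g g0 c" "has_linearization V h h0 d"
  shows "has_linearization V (\<lambda>w. g w * h w) (g0 * h0) (\<lambda>i. g0 * d i + h0 * c i)"
proof -
  obtain R S where
    R: "polyop V 2 R" "\<And>w. g w = g0 + (\<Sum>i\<in>V. c i * w i) + R w" and
    S: "polyop V 2 S" "\<And>w. h w = h0 + (\<Sum>i\<in>V. d i * w i) + S w"
    using assms unfolding has_linearization_def by blast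
  have fin: "finsupp g0" "finsupp h0" "\<forall>i\<in>V. finsupp (c i)" "\<forall>i\<in>V. finsupp (d i)"
    using assms unfolding has_linearization_def by auto
  define lc where "lc w = (\<Sum>i\<in>V. c i * w i)" for w
  define ld where "ld w = (\<Sum>i\<in>V. d i * w i)" for w
  have l: "polyop V 1 lc" "polyop V 1 ld"
    unfolding lc_def ld_def using fin by (auto intro!: polyop_sum polyop_mult0 polyop.var simp del: One_nat_def)
  define T where "T w = lc w * ld w + (R w * (h0 + ld w + S w) + (g0 + lc w) * S w)" for w
  have h0: "polyop V 0 (\<lambda>w. h0 + ld w + S w)" "polyop V 0 (\<lambda>w. g0 + lc w)"
    using fin l R S by (auto intro!: polyop.add polyop.const intro: polyop_to_zero)
  have "polyop V 2 (\<lambda>w. lc w * ld w)"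
    using polyop.mult[OF l] by (simp add: numeral_2_eq_2)
  moreover have "polyop V 2 (\<lambda>w. R w * (h0 + ld w + S w))"
    using polyop.mult[OF R(1) h0(1)] by simp
  moreover have "polyop V 2 (\<lambda>w. (g0 + lc w) * S w)"
    using polyop.mult[OF h0(2) S(1)] unfolding add_0 .
  ultimately have "polyop V 2 T" unfolding T_def by (intro polyop.add)
  moreover have "g w * h w = g0 * h0 + (\<Sum>i\<in>V. (g0 * d i + h0 * c i) * w i) + T w" for w
  proof -
    have "(\<Sum>i\<in>V. (g0 * d i + h0 * c i) * w i) = g0 * ld w + h0 * lc w"
      unfolding lc_def ld_def by (simp add: distrib_right sum.distrib sum_distrib_left mult.assoc)
    then show ?thesis
      unfolding R(2) S(2) T_def lc_def[symmetric] ld_def[symmetric] by (simp add: algebra_simps)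
  qed
  ultimately show ?thesis
    using fin unfolding has_linearization_def by (blast intro: finsupp_add finsupp_mult)
qed

lemma has_linearization_cong:
  "has_linearization V g g0 c \<Longrightarrow> (\<And>w. g w = g' w) \<Longrightarrow> g0 = g0' \<Longrightarrow> (\<And>i. i \<in> V \<Longrightarrow> c i = c' i) \<Longrightarrow>
   has_linearization V g' g0' c'"
  unfolding has_linearization_def by (simp cong: sum.cong ball_cong)

lemma has_linearization_power:
  assumes "finite V" "i \<in> V" "finsupp (f i)"
  shows "has_linearization V (\<lambda>w. (f i + w i) ^ e) (f i ^ e)
           (\<lambda>j. if j = i then of_nat e * f i ^ (e - 1) else 0)"
proof (induction e)
  case 0
  show ?case by (rule has_linearization_cong[OF has_linearization_const[of 1]]) auto
next
  case (Suc e)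
  show ?case
    by (rule has_linearization_cong[OF has_linearization_mult[OF has_linearization_var[where f = f, OF assms] Suc]])
       (cases e; auto simp: algebra_simps)+
qed

lemma has_linearization_prod:
  assumes "finite V" "\<And>i. i \<in> V \<Longrightarrow> finsupp (f i)" "S \<subseteq> V"
  shows "has_linearization V (\<lambda>w. \<Prod>i\<in>S. (f i + w i) ^ e i) (\<Prod>i\<in>S. f i ^ e i)
           (\<lambda>j. if j \<in> S then of_nat (e j) * f j ^ (e j - 1) * (\<Prod>i\<in>S - {j}. f i ^ e i) else 0)"
  using finite_subset[OF assms(3,1)] assms(3)
proof (induction S rule: finite_induct)
  case empty
  show ?case by (rule has_linearization_cong[OF has_linearization_const[of 1]]) auto
next
  case (insert x S)
  have *: "has_linearization V (\<lambda>w. (f x + w x) ^ e x) (f x ^ e x)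
           (\<lambda>j. if j = x then of_nat (e x) * f x ^ (e x - 1) else 0)"
    using insert.prems assms by (intro has_linearization_power) auto
  have **: "has_linearization V (\<lambda>w. \<Prod>i\<in>S. (f i + w i) ^ e i) (\<Prod>i\<in>S. f i ^ e i)
           (\<lambda>j. if j \<in> S then of_nat (e j) * f j ^ (e j - 1) * (\<Prod>i\<in>S - {j}. f i ^ e i) else 0)"
    using insert by blast
  show ?case
  proof (rule has_linearization_cong[OF has_linearization_mult[OF * **]])
    fix j assume "j \<in> V"
    consider "j = x" | "j \<in> S" "j \<noteq> x" | "j \<notin> S" "j \<noteq> x" by blast
    then show "f x ^ e x * (if j \<in> S then of_nat (e j) * f j ^ (e j - 1) * (\<Prod>i\<in>S - {j}. f i ^ e i) else 0) +
        (\<Prod>i\<in>S. f i ^ e i) * (if j = x then of_nat (e x) * f x ^ (e x - 1) else 0) =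
        (if j \<in> insert x S then of_nat (e j) * f j ^ (e j - 1) * (\<Prod>i\<in>insert x S - {j}. f i ^ e i) else 0)"
    proof cases
      case 1
      then show ?thesis using insert by simp
    next
      case 2
      then have "insert x S - {j} = insert x (S - {j})" by auto
      then show ?thesis using 2 insert by (simp add: mult_ac)
    next
      case 3
      then show ?thesis by simp
    qed
  qed (use insert in auto)
qed

lemma monomial_value_linearization:
  assumes "finite V" "\<And>i. i \<in> V \<Longrightarrow> finsupp (f i)"
  shows "has_linearization V (\<lambda>w. monomial_value V (\<lambda>i. f i + w i) \<mu>) (monomial_value V f \<mu>)
     (\<lambda>i. of_nat (Poly_Mapping.lookup \<mu> i) * monomial_value V f (\<mu> - Poly_Mapping.single i 1))"
  unfolding monomial_value_def
proof (rule has_linearization_cong[OF has_linearization_prod[OF assms order.refl, where e = "Poly_Mapping.lookup \<mu>"]])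
  fix i assume i: "i \<in> V"
  have "(\<Prod>j\<in>V. f j ^ Poly_Mapping.lookup (\<mu> - Poly_Mapping.single i 1) j) =
      f i ^ (Poly_Mapping.lookup \<mu> i - 1) * (\<Prod>j\<in>V - {i}. f j ^ Poly_Mapping.lookup (\<mu> - Poly_Mapping.single i 1) j)"
    using assms(1) i by (simp add: prod.remove lookup_minus)
  also have "(\<Prod>j\<in>V - {i}. f j ^ Poly_Mapping.lookup (\<mu> - Poly_Mapping.single i 1) j) =
      (\<Prod>j\<in>V - {i}. f j ^ Poly_Mapping.lookup \<mu> j)"
    by (intro prod.cong) (auto simp: lookup_minus lookup_single)
  finally show "(if i \<in> V then of_nat (Poly_Mapping.lookup \<mu> i) * f i ^ (Poly_Mapping.lookup \<mu> i - 1) *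
        (\<Prod>i\<in>V - {i}. f i ^ Poly_Mapping.lookup \<mu> i) else 0) =
      of_nat (Poly_Mapping.lookup \<mu> i) * (\<Prod>j\<in>V. f j ^ Poly_Mapping.lookup (\<mu> - Poly_Mapping.single i 1) j)"
    using i by (simp add: mult.assoc)
qed (use assms in auto)

lemma has_linearization_sum:
  "(\<And>i. i \<in> S \<Longrightarrow> has_linearization V (g i) (g0 i) (c i)) \<Longrightarrow>
   has_linearization V (\<lambda>w. \<Sum>i\<in>S. g i w) (\<Sum>i\<in>S. g0 i) (\<lambda>j. \<Sum>i\<in>S. c i j)"
  by (induction S rule: infinite_finite_induct)
     (auto intro: has_linearization_add has_linearization_const)

text \<open>
  Taylor expansion of \<open>F\<close> at \<open>f\<close>: it holds for monomials by the product rule, hence for \<open>F\<close>.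
\<close>

lemma substitute_linearization:
  assumes V: "finite V" "in_variables V F" and f: "\<And>i. i \<in> V \<Longrightarrow> finsupp (f i)"
  shows "has_linearization V (\<lambda>w. substitute F (\<lambda>i. f i + w i)) (substitute F f)
           (\<lambda>i. substitute (partial_deriv i F) f)"
  unfolding substitute_eq_monomial_values[OF V] substitute_partial_deriv[OF V]
proof (rule has_linearization_sum)
  fix \<mu>
  let ?c = "fps_const [:Poly_Mapping.lookup F \<mu>:] :: log_series"
  have c: "has_linearization V (\<lambda>w. ?c) ?c (\<lambda>i. 0)"
    by (rule has_linearization_const[OF finsupp_const])
  show "has_linearization V (\<lambda>w. ?c * monomial_value V (\<lambda>i. f i + w i) \<mu>) (?c * monomial_value V f \<mu>)
     (\<lambda>i. ?c * (of_nat (Poly_Mapping.lookup \<mu> i) * monomial_value V f (\<mu> - Poly_Mapping.single i 1)))"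
    by (rule has_linearization_cong[OF has_linearization_mult[OF c monomial_value_linearization[OF V(1) f]]]) auto
qed

text \<open>
  Polynomials respect congruences. This compares the derivatives of \<open>F\<close> at \<open>\<phi>\<close>, where they
  are given, with those at a truncation of \<open>\<phi>\<close>, where the expansion takes place.
\<close>

lemma dvd_substitute_diff:
  assumes "\<And>i. d dvd f i - g i"
  shows "d dvd substitute F f - substitute F g"
proof -
  have mult: "d dvd a * b - a' * b'" if "d dvd a - a'" "d dvd b - b'" for a a' b b' :: log_series
  proof -
    have "a * b - a' * b' = a * (b - b') + (a - a') * b'" by (simp add: algebra_simps)
    then show ?thesis using that by (simp add: dvd_add)
  qed
  have pow: "d dvd f i ^ e - g i ^ e" for i e
    by (induction e) (auto intro!: mult assms)
  have "d dvd (\<Prod>i\<in>S. f i ^ e i) - (\<Prod>i\<in>S. g i ^ e i)" for S e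
    by (induction S rule: infinite_finite_induct) (auto intro!: mult pow)
  then show ?thesis
    unfolding substitute_def sum_subtractf[symmetric] right_diff_distrib[symmetric]
    by (intro dvd_sum dvd_mult) auto
qed

section \<open>The equation for the tail of the solution\<close>

lemma qshift_iterate_nth:
  "fps_nth ((qshift q ^^ j) f) k = smult (q ^ (k * j)) (pcompose (f $ k) [:of_nat j, 1:])"
proof (induction j)
  case 0
  show ?case by (simp add: pcompose_idR)
next
  case (Suc j)
  have "pcompose (pcompose p [:of_nat j, 1:]) [:1, 1:] = pcompose p [:of_nat (Suc j), 1:]" for p :: "complex poly"
    by (simp add: pcompose_assoc[symmetric] pcompose_pCons add.commute)
  moreover have "qshift q g $ k = smult (q ^ k) (pcompose (g $ k) [:1, 1:])" for g
    by (simp add: qshift_def)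
  ultimately show ?case
    using Suc by (simp add: pcompose_smult power_add del: of_nat_Suc)
qed

lemma power_dvd_iff_nth_0: "fps_X ^ s dvd (f :: log_series) \<longleftrightarrow> (\<forall>k<s. f $ k = 0)"
proof
  assume "fps_X ^ s dvd f"
  then show "\<forall>k<s. f $ k = 0" by (auto simp: dvd_def fps_X_power_mult_nth)
next
  assume "\<forall>k<s. f $ k = 0"
  then have "f = fps_X ^ s * fps_shift s f"
    by (intro fps_ext) (simp add: fps_X_power_mult_nth)
  then show "fps_X ^ s dvd f" by (rule dvdI)
qed

lemma eq_power_mult_shift: "fps_X ^ s dvd (f :: log_series) \<Longrightarrow> f = fps_X ^ s * fps_shift s f"
  unfolding power_dvd_iff_nth_0 by (rule fps_ext) (simp add: fps_X_power_mult_nth)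

text \<open>
  For the shifts of \<open>y\<close>, these are the series \<open>u\<^sub>j\<close> with \<open>\<sigma>\<^sup>j \<phi> = \<sigma>\<^sup>j \<phi>\<^sub>N + x\<^sup>N u\<^sub>j\<close>, placed at index
  \<open>j + 1\<close>. At index 0, the place of the variable \<open>x\<close> itself, there is nothing to expand and the entry is 0.
  Dividing by \<open>x\<^sup>N\<close> although the tail starts at \<open>x\<^bsup>N+1\<^esup>\<close> leaves \<open>u\<^sub>j\<close> without constant term.
\<close>

definition tail_args :: "complex \<Rightarrow> nat \<Rightarrow> log_series \<Rightarrow> nat \<Rightarrow> log_series" where
  "tail_args q N \<phi> i = fps_shift N (qdiff_args q \<phi> i - qdiff_args q (fps_cutoff (Suc N) \<phi>) i)"

lemma tail_args_0: "tail_args q N \<phi> 0 = 0"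
  by (simp add: tail_args_def qdiff_args_def)

lemma tail_args_Suc_nth:
  "tail_args q N \<phi> (Suc j) $ k =
     (if k = 0 then 0 else smult (q ^ ((N + k) * j)) (pcompose (\<phi> $ (N + k)) [:of_nat j, 1:]))"
  by (simp add: tail_args_def qdiff_args_def qshift_iterate_nth add.commute)

lemma qdiff_args_split:
  "qdiff_args q \<phi> i = qdiff_args q (fps_cutoff (Suc N) \<phi>) i + fps_X ^ N * tail_args q N \<phi> i"
proof -
  have "fps_X ^ N dvd qdiff_args q \<phi> i - qdiff_args q (fps_cutoff (Suc N) \<phi>) i"
    unfolding power_dvd_iff_nth_0
    by (cases i) (auto simp: qdiff_args_def qshift_iterate_nth)
  from eq_power_mult_shift[OF this] show ?thesis by (simp add: tail_args_def algebra_simps)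
qed

lemma finsupp_qdiff_args_cutoff: "finsupp (qdiff_args q (fps_cutoff s \<phi>) i)"
proof (cases i)
  case 0
  then show ?thesis by (simp add: qdiff_args_def)
next
  case (Suc j)
  then show ?thesis unfolding finsupp_def
    by (intro exI[of _ s]) (auto simp: qdiff_args_def qshift_iterate_nth)
qed

lemma finsupp_substitute:
  assumes "\<And>i. finsupp (f i)"
  shows "finsupp (substitute F f)"
  unfolding substitute_def
  by (intro finsupp_sum finsupp_mult finsupp_prod finsupp_power finsupp_const assms)

text \<open>
  Truncating \<open>\<phi>\<close> beyond \<open>x\<^sup>m\<close> leaves the leading term \<open>a x\<^sup>m\<close> untouched; in exchange the
  remaining coefficients become an element of \<open>\<complex>[t][x]\<close>.
\<close>

lemma partial_deriv_at_cutoff: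
  assumes "m < N"
    and "substitute G (qdiff_args q \<phi>) = fps_const [:a:] * fps_X ^ m + fps_const b * fps_X ^ (m + 1)
               + fps_X ^ (m + 2) * \<psi>"
  shows "\<exists>c. finsupp c \<and> substitute G (qdiff_args q (fps_cutoff (Suc N) \<phi>)) =
           fps_X ^ m * fps_const [:a:] + fps_X ^ (m + 1) * c"
proof -
  let ?D = "substitute G (qdiff_args q (fps_cutoff (Suc N) \<phi>))"
  have "fps_X ^ N dvd substitute G (qdiff_args q \<phi>) - ?D"
    by (rule dvd_substitute_diff) (simp add: qdiff_args_split[of q \<phi> _ N])
  then have "?D $ k = substitute G (qdiff_args q \<phi>) $ k" if "k \<le> m" for k
    using that assms(1) by (auto simp: power_dvd_iff_nth_0)
  moreover have "substitute G (qdiff_args q \<phi>) $ k = (if k = m then [:a:] else 0)" if "k \<le> m" for k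
  proof -
    have "(fps_X ^ (m + 2) * \<psi>) $ k = 0" "(fps_const b * fps_X ^ (m + 1)) $ k = 0"
      using that unfolding fps_X_power_mult_nth fps_mult_left_const_nth fps_X_power_nth by auto
    then show ?thesis
      by (simp only: assms(2) fps_add_nth) (simp add: fps_X_power_nth)
  qed
  ultimately have "(?D - fps_X ^ m * fps_const [:a:]) $ k = 0" if "k < m + 1" for k
    using that by (simp add: fps_X_power_mult_nth)
  then have "fps_X ^ (m + 1) dvd ?D - fps_X ^ m * fps_const [:a:]"
    unfolding power_dvd_iff_nth_0 by blast
  from eq_power_mult_shift[OF this]
  have "?D = fps_X ^ m * fps_const [:a:] + fps_X ^ (m + 1) * fps_shift (m + 1) (?D - fps_X ^ m * fps_const [:a:])"
    by (simp only: diff_eq_eq add.commute)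
  moreover have "finsupp (fps_shift (m + 1) (?D + fps_const [:- a:] * fps_X ^ m))"
    by (intro finsupp_shift finsupp_add finsupp_mult finsupp_power finsupp_X finsupp_const
        finsupp_substitute finsupp_qdiff_args_cutoff)
  moreover have "?D + fps_const [:- a:] * fps_X ^ m = ?D - fps_X ^ m * fps_const [:a:]"
    by (simp add: fps_eq_iff fps_X_power_mult_nth)
  ultimately show ?thesis by metis
qed

text \<open>
  Taylor expansion at the truncation \<open>\<phi>\<^sub>N\<close>. The linear terms are \<open>x\<^bsup>N+m\<^esup> \<Sum>\<^sub>j a\<^sub>j u\<^sub>j\<close>, up to higher order, and the quadratic ones are divisible by \<open>x\<^bsup>2N\<^esup>\<close>. The value
  at \<open>\<phi>\<^sub>N\<close> balances both, so it is divisible by \<open>x\<^bsup>N+m+1\<^esup>\<close>, because the \<open>u\<^sub>j\<close> have no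
  constant term.
\<close>

lemma reduced_equation:
  fixes q :: complex and n m N :: nat and F :: cpolynomial and \<phi> :: log_series
  assumes F: "in_variables {..n + 1} F"
    and sol: "formal_solution q F \<phi>"
    and lin: "\<And>j. j \<le> n \<Longrightarrow> \<exists>\<psi> :: log_series.
           substitute (partial_deriv (Suc j) F) (qdiff_args q \<phi>) =
             fps_const [:a j:] * fps_X ^ m + fps_const (b j) * fps_X ^ (m + 1)
               + fps_X ^ (m + 2) * \<psi>"
    and N: "m < N"
  shows "\<exists>H. polyop {..n + 1} 0 H \<and>
    (\<Sum>j\<le>n. fps_const [:a j:] * tail_args q N \<phi> (Suc j)) = fps_X * H (tail_args q N \<phi>)"
proof -
  let ?V = "{..n + 1}"
  define f where "f = qdiff_args q (fps_cutoff (Suc N) \<phi>)"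
  define U where "U = tail_args q N \<phi>"
  have f: "finsupp (f i)" for i unfolding f_def by (rule finsupp_qdiff_args_cutoff)
  obtain R where R: "polyop ?V 2 R" "\<And>w. substitute F (\<lambda>i. f i + w i) =
      substitute F f + (\<Sum>i\<in>?V. substitute (partial_deriv i F) f * w i) + R w"
    using substitute_linearization[OF _ F, of f] f unfolding has_linearization_def by blast
  obtain h where h: "polyop ?V 0 h" "\<And>u. R (\<lambda>i. fps_X ^ N * u i) = fps_X ^ (2 * N) * h u"
    using polyop_scale[OF R(1), of N] by blast
  have "\<forall>j\<in>{..n}. \<exists>c. finsupp c \<and> substitute (partial_deriv (Suc j) F) f =
           fps_X ^ m * fps_const [:a j:] + fps_X ^ (m + 1) * c"
    using lin partial_deriv_at_cutoff[OF N] unfolding f_def by (metis atMost_iff)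
  then obtain c where c: "\<And>j. j \<le> n \<Longrightarrow> finsupp (c j)"
    "\<And>j. j \<le> n \<Longrightarrow> substitute (partial_deriv (Suc j) F) f =
           fps_X ^ m * fps_const [:a j:] + fps_X ^ (m + 1) * c j"
    unfolding bchoice_iff by auto
  \<comment> \<open>As \<open>N > m\<close>, at least one factor \<open>x\<close> is left of \<open>x\<^bsup>2N\<^esup>\<close> after dividing by \<open>x\<^bsup>N+m\<^esup>\<close>.\<close>
  obtain s where s: "N = m + 1 + s" using N by (metis Suc_eq_plus1 Suc_leI le_Suc_ex)
  define L where "L = (\<Sum>j\<le>n. fps_const [:a j:] * U (Suc j))"
  define E where "E u = (\<Sum>j\<le>n. c j * u (Suc j)) + fps_X ^ s * h u" for u
  have "qdiff_args q \<phi> = (\<lambda>i. f i + fps_X ^ N * U i)"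
    unfolding f_def U_def using qdiff_args_split by blast
  then have "0 = substitute F (\<lambda>i. f i + fps_X ^ N * U i)"
    using sol unfolding formal_solution_def by simp
  also have "\<dots> = substitute F f + (\<Sum>i\<in>?V. substitute (partial_deriv i F) f * (fps_X ^ N * U i))
      + fps_X ^ (2 * N) * h U"
    unfolding R(2) h(2) ..
  also have "(\<Sum>i\<in>?V. substitute (partial_deriv i F) f * (fps_X ^ N * U i)) =
      (\<Sum>j\<le>n. substitute (partial_deriv (Suc j) F) f * (fps_X ^ N * U (Suc j)))"
    unfolding Suc_eq_plus1[symmetric] by (simp only: sum.atMost_Suc_shift) (simp add: U_def tail_args_0)
  also have "\<dots> = (\<Sum>j\<le>n. fps_X ^ (N + m) * (fps_const [:a j:] * U (Suc j)) +
       fps_X ^ (N + m) * (fps_X * (c j * U (Suc j))))"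
    by (intro sum.cong refl) (simp add: c(2) power_add algebra_simps)
  also have "\<dots> = fps_X ^ (N + m) * (L + fps_X * (\<Sum>j\<le>n. c j * U (Suc j)))"
    unfolding L_def by (simp add: sum.distrib sum_distrib_left distrib_left)
  also have "fps_X ^ (2 * N) * h U = fps_X ^ (N + m) * (fps_X * (fps_X ^ s * h U))"
  proof -
    have "2 * N = (N + m) + 1 + s" using s by simp
    then show ?thesis by (simp only: power_add power_one_right mult.assoc)
  qed
  finally have eq: "substitute F f = - (fps_X ^ (N + m) * (L + fps_X * E U))"
    unfolding E_def by (simp add: algebra_simps eq_neg_iff_add_eq_0)
  have "L $ 0 = 0" unfolding L_def U_def by (simp add: fps_sum_nth tail_args_Suc_nth)
  then have "fps_X dvd L" using power_dvd_iff_nth_0[of 1 L] by simp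
  then have "fps_X ^ (N + m) * fps_X dvd substitute F f"
    unfolding eq dvd_minus_iff by (intro mult_dvd_mono) auto
  then have "fps_X ^ (N + m + 1) dvd substitute F f" by (simp add: mult.commute)
  note shift = eq_power_mult_shift[OF this]
  define c0 where "c0 = fps_shift (N + m + 1) (substitute F f)"
  have c0: "substitute F f = fps_X ^ (N + m) * (fps_X * c0)"
    using shift unfolding c0_def[symmetric] by (simp add: mult_ac)
  have "fps_X ^ (N + m) * L = fps_X ^ (N + m) * (fps_X * - (c0 + E U))"
    using eq unfolding c0 by (simp add: algebra_simps eq_neg_iff_add_eq_0)
  then have L: "L = fps_X * - (c0 + E U)" by simp
  have "finsupp c0" unfolding c0_def using f by (intro finsupp_shift finsupp_substitute)
  then have "polyop ?V 0 (\<lambda>u. c0 + E u)"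
    unfolding E_def using c(1) h(1) polyop_to_zero[OF polyop.var]
    by (intro polyop.add polyop.const polyop_sum polyop_mult0 finsupp_power finsupp_X) auto
  then have "polyop ?V 0 (\<lambda>u. fps_const (- 1) * (c0 + E u))"
    by (intro polyop_mult0 finsupp_const)
  moreover have "fps_const (- 1) * g = - g" for g :: log_series
    by (simp add: fps_eq_iff)
  ultimately have "polyop ?V 0 (\<lambda>u. - (c0 + E u))" by simp
  then show ?thesis using L unfolding L_def U_def by blast
qed

section \<open>Growth of degrees and norms of the coefficients\<close>

text \<open>
  The scale \<open>l\<close> of the weighted norm at which a unit translation, acting on degree \<open>C k\<close>, costs at most \<open>Q\<^sup>k\<close>.
\<close>

lemma exists_scale_power_le:
  fixes Q :: real assumes "Q > 1"
  shows "\<exists>l>0. (1 + 1 / l) ^ C \<le> Q"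
proof -
  have "((\<lambda>l::real. (1 + 1 / l) ^ C) \<longlongrightarrow> (1 + 0) ^ C) at_top"
    by (intro tendsto_intros tendsto_divide_0[OF tendsto_const] filterlim_at_top_imp_at_infinity filterlim_ident)
  then have "eventually (\<lambda>l::real. (1 + 1 / l) ^ C < Q) at_top"
    using assms by (intro order_tendstoD) auto
  then have "eventually (\<lambda>l::real. (1 + 1 / l) ^ C < Q \<and> l > 0) at_top"
    by (intro eventually_conj eventually_gt_at_top)
  then show ?thesis
    using eventually_happens[of _ "at_top :: real filter"] by (auto dest: less_imp_le)
qed

text \<open>
  Translations preserve the leading term, so the leading coefficient gets multiplied by \<open>\<Sum>\<^sub>j d\<^sub>j\<close>.
\<close>

lemma degree_shift_combination:
  fixes d :: "nat \<Rightarrow> complex"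
  assumes "(\<Sum>j\<le>n. d j) \<noteq> 0"
  shows "degree p \<le> degree (\<Sum>j\<le>n. smult (d j) (pcompose p [:of_nat j, 1:]))"
proof (cases "p = 0")
  case False
  have "coeff (pcompose p [:of_nat j, 1:]) (degree p) = lead_coeff p" for j
    using lead_coeff_comp[of "[:of_nat j, 1:]" p] by (simp add: degree_pcompose)
  then have "coeff (\<Sum>j\<le>n. smult (d j) (pcompose p [:of_nat j, 1:])) (degree p) = (\<Sum>j\<le>n. d j) * lead_coeff p"
    by (simp add: coeff_sum sum_distrib_right)
  then show ?thesis using assms False by (intro le_degree) auto
qed simp

text \<open>
  For each \<open>j < n\<close> the modulus of \<open>q\<^bsup>kn\<^esup>\<close> is at least \<open>|q|\<^sup>N\<close> times that of \<open>q\<^bsup>kj\<^esup>\<close>, a factor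
  that outweighs the sum of the other coefficients.
\<close>

lemma leading_term_dominates:
  fixes q :: complex
  assumes q: "norm q > 1" and an: "a n \<noteq> 0"
    and dom: "2 * (\<Sum>j<n. norm (a j)) \<le> norm q ^ N * norm (a n)" and k: "N \<le> k"
  shows "(\<Sum>j\<le>n. a j * q ^ (k * j)) \<noteq> 0"
proof
  assume "(\<Sum>j\<le>n. a j * q ^ (k * j)) = 0"
  then have "a n * q ^ (k * n) = - (\<Sum>j<n. a j * q ^ (k * j))"
    by (simp add: lessThan_Suc_atMost[symmetric] eq_neg_iff_add_eq_0 add.commute)
  then have "norm (a n) * norm q ^ (k * n) = norm (\<Sum>j<n. a j * q ^ (k * j))"
    by (metis norm_minus_cancel norm_mult norm_power)
  also have "\<dots> \<le> (\<Sum>j<n. norm (a j) * norm q ^ (k * j))"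
    by (rule sum_norm_le) (simp add: norm_mult norm_power)
  finally have "norm q ^ N * (norm (a n) * norm q ^ (k * n)) \<le>
      norm q ^ N * (\<Sum>j<n. norm (a j) * norm q ^ (k * j))"
    by (rule mult_left_mono) simp
  also have "\<dots> = (\<Sum>j<n. norm (a j) * (norm q ^ N * norm q ^ (k * j)))"
    by (simp add: sum_distrib_left mult.left_commute)
  also have "\<dots> \<le> (\<Sum>j<n. norm (a j) * norm q ^ (k * n))"
  proof (intro sum_mono mult_left_mono)
    fix j assume "j \<in> {..<n}"
    then have "k * Suc j \<le> k * n" by (intro mult_le_mono) auto
    then show "norm q ^ N * norm q ^ (k * j) \<le> norm q ^ (k * n)"
      unfolding power_add[symmetric] using q k by (intro power_increasing) auto
  qed auto
  finally have "norm q ^ N * norm (a n) * norm q ^ (k * n) \<le> (\<Sum>j<n. norm (a j)) * norm q ^ (k * n)"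
    by (simp only: sum_distrib_right mult.assoc)
  moreover have "norm q ^ (k * n) > 0" using q by (intro zero_less_power) auto
  ultimately have "norm q ^ N * norm (a n) \<le> (\<Sum>j<n. norm (a j))"
    by (rule mult_right_le_imp_le)
  then have "norm q ^ N * norm (a n) \<le> 0" using dom by linarith
  moreover have "norm q ^ N * norm (a n) > 0"
    using an q by (intro mult_pos_pos zero_less_power) auto
  ultimately show False by linarith
qed

text \<open>
  Here \<open>P k\<close> is the coefficient of \<open>x\<^bsup>N+k\<^esup>\<close> in the solution, and \<open>U (Suc j)\<close> is \<open>u\<^sub>j\<close>. The
  assumption \<open>dom\<close> on \<open>N\<close> says that the term \<open>j = n\<close> outweighs twice the others; the factor 2
  leaves half of it for estimating \<open>u\<^sub>n\<close> by \<open>H\<close>.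
\<close>

lemma coefficient_growth:
  fixes q :: complex and P :: "nat \<Rightarrow> complex poly"
  assumes q: "norm q > 1" and an: "a n \<noteq> 0"
    and dom: "2 * (\<Sum>j<n. norm (a j)) \<le> norm q ^ N * norm (a n)"
    and H: "polyop {..n + 1} 0 H"
    and U0: "U 0 = 0" and P0: "P 0 = 0"
    and U: "\<And>j k. U (Suc j) $ k = smult (q ^ ((N + k) * j)) (pcompose (P k) [:of_nat j, 1:])"
    and eq: "(\<Sum>j\<le>n. fps_const [:a j:] * U (Suc j)) = fps_X * H U"
  shows "\<exists>C l r. l > 0 \<and> r > 0 \<and> (\<forall>k. degree (P k) \<le> C * k \<and> wnorm l (P k) * r ^ k \<le> 1)"
proof -
  have eqk: "(\<Sum>j\<le>n. smult (a j) (U (Suc j) $ Suc k)) = H U $ k" for k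
    using arg_cong[OF eq, of "\<lambda>f. f $ Suc k"] by (simp add: fps_sum_nth)
  obtain C where C: "\<And>D K u. \<forall>i\<in>{..n + 1}. \<forall>k\<le>K. degree (u i $ k) \<le> D * k \<Longrightarrow>
      (\<forall>k\<le>K. degree (H u $ k) \<le> C + D * k)"
    using polyop_degree[OF H] by metis
  have degU: "degree (U i $ k) \<le> degree (P k)" for i k
    using q by (cases i) (auto simp: U0 U degree_pcompose degree_smult_eq)
  \<comment> \<open>The coefficient of \<open>H\<close> at \<open>k - 1\<close> has degree at most \<open>C + C (k - 1) = C k\<close>: taking the
    slope equal to the constant excess closes the induction.\<close>
  have deg: "degree (P k) \<le> C * k" for k
  proof (induction k rule: less_induct)
    case (less k)
    show ?case
    proof (cases k)
      case 0
      then show ?thesis by (simp add: P0)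
    next
      case (Suc k')
      have "\<forall>i\<in>{..n + 1}. \<forall>k\<le>k'. degree (U i $ k) \<le> C * k"
        using less Suc degU by (meson le_imp_less_Suc order_trans)
      from C[OF this] have "degree (H U $ k') \<le> C * k" by (simp add: Suc)
      moreover have "degree (P k) \<le>
          degree (\<Sum>j\<le>n. smult (a j * q ^ ((N + k) * j)) (pcompose (P k) [:of_nat j, 1:]))"
        by (rule degree_shift_combination) (rule leading_term_dominates[OF q an dom]; simp)
      moreover have "(\<Sum>j\<le>n. smult (a j * q ^ ((N + k) * j)) (pcompose (P k) [:of_nat j, 1:])) = H U $ k'"
        using eqk[of k'] by (simp add: U Suc)
      ultimately show ?thesis by simp
    qed
  qed
  obtain l where l: "l > 0" "(1 + 1 / l) ^ C \<le> norm q" using exists_scale_power_le[OF q] by blast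
  obtain M where M: "\<And>r K u. 0 \<le> r \<Longrightarrow> r \<le> 1 \<Longrightarrow> \<forall>i\<in>{..n + 1}. trunc_norm l r K (u i) \<le> 1 \<Longrightarrow>
           trunc_norm l r K (H u) \<le> M"
    using polyop_trunc_norm[OF H] l(1) by (metis less_imp_le)
  define V where "V k = wnorm l (U (Suc n) $ k)" for k
  \<comment> \<open>Going down from \<open>j + 1\<close> to \<open>j\<close> gains \<open>|q|\<^bsup>N+k\<^esup>\<close> and loses at most \<open>|q|\<^sup>k\<close> by
    translation.\<close>
  have step: "norm q ^ N * wnorm l (U (Suc j) $ k) \<le> wnorm l (U (Suc (Suc j)) $ k)" for j k
  proof -
    let ?p = "pcompose (P k) [:of_nat (Suc j), 1:]"
    have p: "degree ?p \<le> C * k" using deg by (simp add: degree_pcompose)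
    have "pcompose (P k) [:of_nat j, 1:] = pcompose ?p [:-1, 1:]"
      by (simp add: pcompose_assoc[symmetric] pcompose_pCons)
    then have "wnorm l (pcompose (P k) [:of_nat j, 1:]) \<le> wnorm (l + 1) ?p"
      using wnorm_translate[of l ?p "-1"] l(1) by simp
    also have "\<dots> \<le> ((l + 1) / l) ^ (C * k) * wnorm l ?p"
      using p l(1) by (intro wnorm_enlarge) auto
    also have "((l + 1) / l) ^ (C * k) = ((1 + 1 / l) ^ C) ^ k"
      using l(1) by (simp add: power_mult add_divide_distrib)
    also have "\<dots> * wnorm l ?p \<le> norm q ^ k * wnorm l ?p"
      using l by (intro mult_right_mono power_mono wnorm_nonneg) auto
    finally have "norm q ^ N * norm q ^ ((N + k) * j) * wnorm l (pcompose (P k) [:of_nat j, 1:]) \<le>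
        norm q ^ N * norm q ^ ((N + k) * j) * (norm q ^ k * wnorm l ?p)"
      by (rule mult_left_mono) simp
    also have "\<dots> = norm q ^ ((N + k) * Suc j) * wnorm l ?p"
    proof -
      have "norm q ^ ((N + k) * Suc j) = norm q ^ N * norm q ^ k * norm q ^ ((N + k) * j)"
        by (simp add: power_add)
      then show ?thesis by (simp only: mult_ac)
    qed
    finally show ?thesis
      unfolding U wnorm_smult norm_power by (simp only: mult.assoc)
  qed
  have qN: "norm q ^ N \<ge> 1" using q by (intro one_le_power) auto
  have mono: "wnorm l (U (Suc j) $ k) \<le> wnorm l (U (Suc (Suc j)) $ k)" for j k
  proof -
    have "1 * wnorm l (U (Suc j) $ k) \<le> norm q ^ N * wnorm l (U (Suc j) $ k)"
      using qN l(1) by (intro mult_right_mono wnorm_nonneg) auto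
    then show ?thesis using step[of j k] by simp
  qed
  have le_V: "wnorm l (U (Suc j) $ k) \<le> V k" if "j \<le> n" for j k
    using that unfolding V_def by (rule lift_Suc_mono_le[of "\<lambda>j. wnorm l (U (Suc j) $ k)", OF mono])
  have lt_V: "norm q ^ N * wnorm l (U (Suc j) $ k) \<le> V k" if "j < n" for j k
    using step[of j k] le_V[of "Suc j" k] that by simp
  have V_bound: "norm (a n) * V (Suc k) \<le> 2 * wnorm l (H U $ k)" for k
  proof -
    let ?S = "\<Sum>j<n. smult (a j) (U (Suc j) $ Suc k)"
    have "smult (a n) (U (Suc n) $ Suc k) = H U $ k + - ?S"
      using eqk[of k] by (simp add: lessThan_Suc_atMost[symmetric] algebra_simps)
    then have split: "norm (a n) * V (Suc k) \<le> wnorm l (H U $ k) + wnorm l ?S"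
      unfolding V_def wnorm_smult[symmetric]
      using wnorm_add[of l "H U $ k" "- ?S"] l(1) by (simp add: wnorm_minus)
    have "wnorm l ?S \<le> (\<Sum>j<n. norm (a j) * wnorm l (U (Suc j) $ Suc k))"
      using wnorm_sum[of l "\<lambda>j. smult (a j) (U (Suc j) $ Suc k)" "{..<n}"] l(1) by (simp add: wnorm_smult)
    then have "norm q ^ N * wnorm l ?S \<le> norm q ^ N * (\<Sum>j<n. norm (a j) * wnorm l (U (Suc j) $ Suc k))"
      using qN by (intro mult_left_mono) auto
    also have "\<dots> = (\<Sum>j<n. norm (a j) * (norm q ^ N * wnorm l (U (Suc j) $ Suc k)))"
      by (simp add: sum_distrib_left mult_ac)
    also have "\<dots> \<le> (\<Sum>j<n. norm (a j) * V (Suc k))"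
      by (intro sum_mono mult_left_mono lt_V) auto
    also have "\<dots> = (\<Sum>j<n. norm (a j)) * V (Suc k)" by (simp add: sum_distrib_right)
    also have "2 * \<dots> \<le> norm q ^ N * norm (a n) * V (Suc k)"
      using dom l(1) unfolding V_def by (simp flip: mult.assoc add: mult_right_mono wnorm_nonneg)
    finally have "norm q ^ N * (2 * wnorm l ?S) \<le> norm q ^ N * (norm (a n) * V (Suc k))"
      by (simp add: mult_ac)
    then have "2 * wnorm l ?S \<le> norm (a n) * V (Suc k)"
      using qN by simp
    then show ?thesis using split by linarith
  qed
  \<comment> \<open>The factor \<open>r\<close> gained from \<open>x H(u)\<close> has to beat \<open>2 M / |a\<^sub>n|\<close>; the summand 1 keeps \<open>r\<close> defined for
    \<open>M = 0\<close>.\<close>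
  define r where "r = min 1 (norm (a n) / (2 * (\<bar>M\<bar> + 1)))"
  have r: "r > 0" "r \<le> 1" using an by (auto simp: r_def)
  have rM: "2 * r * M \<le> norm (a n)"
  proof -
    have "r * (2 * (\<bar>M\<bar> + 1)) \<le> norm (a n)"
      unfolding pos_le_divide_eq[symmetric, of "2 * (\<bar>M\<bar> + 1)"]
      by (simp add: r_def pos_le_divide_eq[symmetric] add_pos_nonneg)
    moreover have "r * (2 * M) \<le> r * (2 * (\<bar>M\<bar> + 1))" using r by (intro mult_left_mono) auto
    ultimately show ?thesis by (simp add: mult_ac)
  qed
  have U_le: "trunc_norm l r K (U i) \<le> (\<Sum>k\<le>K. V k * r ^ k)" if "i \<le> n + 1" for i K
  proof (cases i)
    case 0
    then show ?thesis using l r unfolding V_def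
      by (auto simp: trunc_norm_def U0 intro!: sum_nonneg mult_nonneg_nonneg wnorm_nonneg)
  next
    case (Suc j)
    then show ?thesis using that r unfolding trunc_norm_def
      by (intro sum_mono mult_right_mono) (auto intro: le_V)
  qed
  \<comment> \<open>The truncated norm of \<open>u\<^sub>n\<close> up to \<open>K + 1\<close> only involves \<open>H(u)\<close> up to \<open>K\<close>, where all arguments lie in the
    unit ball by induction.\<close>
  have total: "(\<Sum>k\<le>K. V k * r ^ k) \<le> 1" for K
  proof (induction K)
    case 0
    show ?case by (simp add: V_def U P0)
  next
    case (Suc K)
    have "trunc_norm l r K (H U) \<le> M"
      using r U_le Suc by (intro M) (auto intro: order_trans)
    have "norm (a n) * (\<Sum>k\<le>Suc K. V k * r ^ k) = (\<Sum>k\<le>K. norm (a n) * V (Suc k) * r ^ Suc k)"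
      by (simp only: sum.atMost_Suc_shift) (simp add: V_def U P0 sum_distrib_left mult.assoc)
    also have "\<dots> \<le> (\<Sum>k\<le>K. 2 * wnorm l (H U $ k) * r ^ Suc k)"
      using r by (intro sum_mono mult_right_mono V_bound) auto
    also have "\<dots> = 2 * r * trunc_norm l r K (H U)"
      by (simp add: trunc_norm_def sum_distrib_left mult_ac)
    also have "\<dots> \<le> 2 * r * M" using \<open>trunc_norm l r K (H U) \<le> M\<close> r by (intro mult_left_mono) auto
    also have "\<dots> \<le> norm (a n) * 1" using rM by simp
    finally show ?case using an by (simp del: sum.atMost_Suc)
  qed
  have "wnorm l (P k) * r ^ k \<le> 1" for k
  proof -
    have "wnorm l (P k) * r ^ k \<le> V k * r ^ k"
      using le_V[of 0 k] r by (intro mult_right_mono) (auto simp: U pcompose_idR)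
    also have "\<dots> \<le> (\<Sum>k\<le>k. V k * r ^ k)"
      using l r unfolding V_def by (intro member_le_sum mult_nonneg_nonneg wnorm_nonneg) auto
    also have "\<dots> \<le> 1" by (rule total)
    finally show ?thesis .
  qed
  then show ?thesis using deg l r by blast
qed

section \<open>Convergence of series with controlled growth\<close>

text \<open>
  The modulus of \<open>Ln x\<close> is at most \<open>\<pi> - ln |x|\<close> for \<open>|x| < 1\<close>, and \<open>|x|\<close> beats every power of \<open>ln |x|\<close>.
\<close>

lemma log_power_times_small:
  fixes l e :: real
  assumes q: "norm q > 1" and l: "l > 0" and e: "e > 0"
  shows "\<exists>R. 0 < R \<and> R \<le> 1 \<and> (\<forall>x. x \<noteq> 0 \<and> norm x < R \<longrightarrow> (max 1 (norm (qlog q x) / l)) ^ C * norm x \<le> e)"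
proof -
  have "Ln q \<noteq> 0" using q by (metis exp_Ln exp_zero norm_one norm_zero order_less_irrefl not_one_less_zero)
  define A where "A = 1 / (norm (Ln q) * l)"
  have A: "A > 0" using \<open>Ln q \<noteq> 0\<close> l by (simp add: A_def)
  have "((\<lambda>s. (1 + A * (pi - ln s)) ^ C * s) \<longlongrightarrow> 0) (at_right 0)"
  proof -
    have "((\<lambda>y. (1 + A * pi + A * y) ^ C / exp y) \<longlongrightarrow> 0) at_top"
    proof (rule Lim_null_comparison)
      have "norm ((1 + A * pi + A * y) ^ C / exp y) \<le> (1 + A * pi + A) ^ C * (y ^ C / exp y)"
        if y: "y \<ge> 1" for y
      proof -
        have "(1 + A * pi) * 1 \<le> (1 + A * pi) * y"
          using y A by (intro mult_left_mono) auto
        then have "(1 + A * pi + A * y) ^ C \<le> ((1 + A * pi + A) * y) ^ C"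
          using y A by (intro power_mono) (auto simp: algebra_simps)
        then show ?thesis using y A
          by (simp add: power_mult_distrib divide_right_mono abs_of_nonneg)
      qed
      then show "eventually (\<lambda>y. norm ((1 + A * pi + A * y) ^ C / exp y) \<le> (1 + A * pi + A) ^ C * (y ^ C / exp y)) at_top"
        using eventually_ge_at_top by (rule eventually_mono[rotated])
      show "((\<lambda>y. (1 + A * pi + A) ^ C * (y ^ C / exp y)) \<longlongrightarrow> 0) at_top"
        by (intro tendsto_mult_right_zero tendsto_power_div_exp_0)
    qed
    moreover have "filterlim (\<lambda>s::real. - ln s) at_top (at_right 0)"
      using ln_at_0 by (simp add: filterlim_uminus_at_top)
    ultimately have "((\<lambda>s. (1 + A * pi + A * - ln s) ^ C / exp (- ln s)) \<longlongrightarrow> 0) (at_right 0)"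
      by (rule filterlim_compose)
    moreover have "eventually (\<lambda>s. (1 + A * pi + A * - ln s) ^ C / exp (- ln s) = (1 + A * (pi - ln s)) ^ C * s) (at_right 0)"
      by (rule eventually_at_right_less[THEN eventually_mono]) (simp add: exp_minus field_simps)
    ultimately show ?thesis by (rule Lim_transform_eventually)
  qed
  then have "eventually (\<lambda>s. (1 + A * (pi - ln s)) ^ C * s < e) (at_right 0)"
    using e by (rule order_tendstoD)
  then obtain R0 where R0: "R0 > 0" "\<And>s. 0 < s \<Longrightarrow> s < R0 \<Longrightarrow> (1 + A * (pi - ln s)) ^ C * s < e"
    unfolding eventually_at_right_field by auto
  have "(max 1 (norm (qlog q x) / l)) ^ C * norm x \<le> e" if x: "x \<noteq> 0" "norm x < min 1 R0" for x
  proof -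
    have "norm (Ln x) \<le> \<bar>Re (Ln x)\<bar> + \<bar>Im (Ln x)\<bar>" by (rule cmod_le)
    also have "\<dots> \<le> - ln (norm x) + pi"
      using x mpi_less_Im_Ln[of x] Im_Ln_le_pi[of x] by simp
    finally have "norm (Ln x) \<le> pi - ln (norm x)" by simp
    then have "A * norm (Ln x) \<le> A * (pi - ln (norm x))" using A by (intro mult_left_mono) auto
    moreover have "norm (qlog q x) / l = A * norm (Ln x)" by (simp add: qlog_def A_def norm_divide)
    moreover have "A * (pi - ln (norm x)) \<ge> 0"
    proof -
      have "ln (norm x) \<le> 0" using x by simp
      then show ?thesis using A pi_gt_zero by (intro mult_nonneg_nonneg) linarith+
    qed
    ultimately have "max 1 (norm (qlog q x) / l) \<le> 1 + A * (pi - ln (norm x))" by simp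
    then have "(max 1 (norm (qlog q x) / l)) ^ C * norm x \<le> (1 + A * (pi - ln (norm x))) ^ C * norm x"
      by (intro mult_right_mono power_mono) auto
    moreover have "\<dots> < e" using R0(2)[of "norm x"] x by simp
    ultimately show ?thesis by linarith
  qed
  then show ?thesis using R0(1) by (intro exI[of _ "min 1 R0"]) auto
qed

text \<open>
  The degree bound with slope \<open>C\<close> turns the growth of \<open>t\<close> into a factor \<open>(max 1 (|t|/l))\<^sup>C\<close> per power
  of \<open>x\<close>, which leaves a geometric series from the index \<open>N + 1\<close> on.
\<close>

lemma uniform_convergence_of_growth:
  fixes \<phi> :: log_series
  assumes q: "norm q > 1" and l: "l > 0" and r: "r > 0"
    and deg: "\<And>k. degree (\<phi> $ (N + Suc k)) \<le> C * Suc k"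
    and bound: "\<And>k. wnorm l (\<phi> $ (N + Suc k)) * r ^ Suc k \<le> 1"
  shows "\<exists>R>0. uniformly_convergent_on {x. x \<noteq> 0 \<and> norm x < R}
           (\<lambda>K x. \<Sum>k = 1..K. poly (\<phi> $ k) (qlog q x) * x ^ k)"
proof -
  obtain R where R: "0 < R" "R \<le> 1"
    "\<And>x. x \<noteq> 0 \<Longrightarrow> norm x < R \<Longrightarrow> (max 1 (norm (qlog q x) / l)) ^ C * norm x \<le> r / 2"
    using log_power_times_small[OF q l, of "r / 2" C] r by auto
  define T where "T i x = poly (\<phi> $ Suc i) (qlog q x) * x ^ Suc i" for i x
  have T: "norm (T (N + k) x) \<le> (1 / 2) ^ Suc k" if x: "x \<noteq> 0" "norm x < R" for k x
  proof -
    let ?p = "\<phi> $ (N + Suc k)" and ?M = "max 1 (norm (qlog q x) / l)"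
    have "norm (poly ?p (qlog q x)) \<le> wnorm (norm (qlog q x)) ?p" by (rule norm_poly_le_wnorm)
    also have "\<dots> \<le> wnorm (?M * l) ?p"
      unfolding wnorm_altdef using l
      by (intro sum_mono mult_left_mono power_mono) (auto simp: max_def field_simps)
    also have "\<dots> \<le> (?M * l / l) ^ (C * Suc k) * wnorm l ?p"
      using l by (intro wnorm_enlarge deg) (auto simp: max_def field_simps)
    also have "\<dots> = (?M ^ C) ^ Suc k * wnorm l ?p"
      using l by (simp only: power_mult) simp
    finally have "norm (poly ?p (qlog q x)) * norm x ^ Suc k \<le> (?M ^ C) ^ Suc k * wnorm l ?p * norm x ^ Suc k"
      by (rule mult_right_mono) simp
    also have "\<dots> = (?M ^ C * norm x) ^ Suc k * wnorm l ?p"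
      by (simp add: power_mult_distrib mult_ac)
    also have "\<dots> \<le> (r / 2) ^ Suc k * wnorm l ?p"
      using R(3)[OF x] l by (intro mult_right_mono power_mono wnorm_nonneg mult_nonneg_nonneg) auto
    also have "\<dots> = (1 / 2) ^ Suc k * (wnorm l ?p * r ^ Suc k)"
      by (simp add: power_divide)
    also have "\<dots> \<le> (1 / 2) ^ Suc k * 1"
      by (intro mult_left_mono bound) auto
    finally have le: "norm (poly ?p (qlog q x)) * norm x ^ Suc k \<le> (1 / 2) ^ Suc k" by simp
    have "norm (T (N + k) x) = norm x ^ N * (norm (poly ?p (qlog q x)) * norm x ^ Suc k)"
      by (simp add: T_def norm_mult norm_power power_add mult_ac)
    also have "\<dots> \<le> 1 * (norm (poly ?p (qlog q x)) * norm x ^ Suc k)"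
      using x R(2) by (intro mult_right_mono power_le_one) auto
    finally show ?thesis using le by simp
  qed
  have "uniformly_convergent_on {x. x \<noteq> 0 \<and> norm x < R} (\<lambda>K x. \<Sum>i<K. T i x)"
  proof (rule Weierstrass_m_test'_ev)
    show "eventually (\<lambda>i. \<forall>x\<in>{x. x \<noteq> 0 \<and> norm x < R}. norm (T i x) \<le> (1 / 2) ^ Suc (i - N)) sequentially"
      using eventually_ge_at_top[of N]
    proof eventually_elim
      case (elim i)
      then show ?case using T[of _ "i - N"] by auto
    qed
    have "summable (\<lambda>k. (1 / 2 :: real) ^ Suc k)"
      unfolding summable_Suc_iff by (rule summable_geometric) simp
    then show "summable (\<lambda>i. (1 / 2 :: real) ^ Suc (i - N))"
      by (subst summable_iff_shift[symmetric, of _ N]) simp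
  qed
  moreover have "(\<Sum>i<K. T i x) = (\<Sum>k = 1..K. poly (\<phi> $ k) (qlog q x) * x ^ k)" for K x
    unfolding T_def by (rule sum.reindex_bij_witness[of _ "\<lambda>k. k - 1" Suc]) auto
  ultimately show ?thesis using R(1) by auto
qed

theorem theorem1:
  fixes q :: complex and n m :: nat and F :: cpolynomial and \<phi> :: log_series
    and a :: "nat \<Rightarrow> complex" and b :: "nat \<Rightarrow> complex poly"
  assumes "norm q > 1"
    and "in_variables {..n + 1} F"
    and "dulac_series \<phi>"
    and "formal_solution q F \<phi>"
    and "a n \<noteq> 0"
    and "\<And>j. j \<le> n \<Longrightarrow> \<exists>\<psi> :: log_series.
           substitute (partial_deriv (Suc j) F) (qdiff_args q \<phi>) =
             fps_const [:a j:] * fps_X ^ m + fps_const (b j) * fps_X ^ (m + 1)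
               + fps_X ^ (m + 2) * \<psi>"
  shows "\<exists>R > 0. \<forall>r \<alpha> \<beta> :: real. r < R \<longrightarrow> \<beta> - \<alpha> < 2 * pi \<longrightarrow>
           uniformly_convergent_on (sector r \<alpha> \<beta>)
             (\<lambda>N x. \<Sum>k = 1..N. poly (fps_nth \<phi> k) (qlog q x) * x ^ k)"
proof -
  \<comment> \<open>Beyond \<open>m\<close>, the truncation order must be so large that the shift \<open>j = n\<close> dominates.\<close>
  obtain N0 where N0: "2 * (\<Sum>j<n. norm (a j)) / norm (a n) < norm q ^ N0"
    using real_arch_pow[OF assms(1)] by blast
  define N where "N = max N0 (Suc m)"
  have "norm q ^ N0 \<le> norm q ^ N" using assms(1) by (intro power_increasing) (auto simp: N_def)
  then have "2 * (\<Sum>j<n. norm (a j)) / norm (a n) \<le> norm q ^ N" using N0 by linarith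
  then have dom: "2 * (\<Sum>j<n. norm (a j)) \<le> norm q ^ N * norm (a n)"
    using assms(5) by (simp add: divide_le_eq)
  have mN: "m < N" by (simp add: N_def)
  obtain H where H: "polyop {..n + 1} 0 H"
    "(\<Sum>j\<le>n. fps_const [:a j:] * tail_args q N \<phi> (Suc j)) = fps_X * H (tail_args q N \<phi>)"
    using reduced_equation[OF assms(2,4,6) mN] by blast
  define P where "P k = (if k = 0 then 0 else \<phi> $ (N + k))" for k
  have "\<exists>C l r. l > 0 \<and> r > 0 \<and> (\<forall>k. degree (P k) \<le> C * k \<and> wnorm l (P k) * r ^ k \<le> 1)"
    using assms(1,5) dom H(1) _ _ _ H(2)
    by (rule coefficient_growth) (simp_all add: tail_args_0 tail_args_Suc_nth P_def)
  then obtain C l r where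
    *: "l > 0" "r > 0" "\<And>k. degree (P k) \<le> C * k" "\<And>k. wnorm l (P k) * r ^ k \<le> 1"
    by blast
  obtain R where R: "R > 0" "uniformly_convergent_on {x. x \<noteq> 0 \<and> norm x < R}
           (\<lambda>K x. \<Sum>k = 1..K. poly (\<phi> $ k) (qlog q x) * x ^ k)"
    using uniform_convergence_of_growth[OF assms(1) *(1,2), of \<phi> N C] *(3,4)[of "Suc _"]
    by (auto simp: P_def)
  have "uniformly_convergent_on (sector r \<alpha> \<beta>) (\<lambda>K x. \<Sum>k = 1..K. poly (\<phi> $ k) (qlog q x) * x ^ k)"
    if "r < R" for r \<alpha> \<beta>
    by (rule uniformly_convergent_on_subset[OF R(2)]) (use that in \<open>auto simp: sector_def\<close>)
  then show ?thesis using R(1) by blast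
qed

end
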